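(* Let $a$ and $b$ be positive integers such that $a$ has a prime factor not dividing $b$. Then there are infinitely many positive integers $n$ such that $bn+1$ does not divide $\binom{an+bn}{an}$. Moreover, if $p$ is a prime with $p\mid a$ and $p\nmid b$, then $f(a,b)\le \frac{p^{\varphi(a+b)}-1}{a+b}$, where $\varphi$ is Euler's totient function.
   Context: For positive integers $a,b$, the function $f(a,b)$ is defined as follows: if $\binom{an+bn}{an}$ is divisible by $bn+1$ for all positive integers $n$, then $f(a,b)=0$; otherwise $f(a,b)$ is the smallest positive integer $n$ such that $\binom{an+bn}{an}$ is not divisible by $bn+1$. *)

theory Defs
  imports Complex_Main "HOL-Number_Theory.Number_Theory"
begin

definition f :: "nat \<Rightarrow> nat \<Rightarrow> nat" where
  "f a b =
    (if \<forall>n>0. (b * n + 1) dvd ((a * n + b * n) choose (a * n)) then 0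
     else (LEAST n. n > 0 \<and> \<not> (b * n + 1) dvd ((a * n + b * n) choose (a * n))))"

end

theory Submission
  imports Defs
begin

text \<open>
  Let \<open>p\<close> be a prime with \<open>p dvd a\<close> and \<open>\<not> p dvd b\<close>, and let \<open>r\<close> be a positive multiple of
  \<open>totient (a + b)\<close>. By Euler's theorem \<open>n = (p ^ r - 1) / (a + b)\<close> is an integer. Then
  \<open>a * n + b * n = p ^ r - 1\<close>, and no binomial coefficient in row \<open>p ^ r - 1\<close> is divisible by
  \<open>p\<close>, whereas \<open>b * n + 1 = p ^ r - a * n\<close> is.
\<close>

text \<open>By the absorption identity, \<open>p ^ r\<close> divides
  \<open>k * (p ^ r choose k)\<close>. If \<open>p\<close> did not divide the coefficient, all of
  \<open>p ^ r\<close> would have to divide \<open>k\<close>, which is positive and too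
  small.\<close>

lemma prime_dvd_prime_power_choose:
  fixes p r k :: nat
  assumes "prime p" "0 < k" "k < p ^ r"
  shows "p dvd (p ^ r choose k)"
proof (rule ccontr)
  assume "\<not> p dvd (p ^ r choose k)"
  then have "coprime (p ^ r) (p ^ r choose k)"
    using assms(1) by (simp add: prime_imp_coprime)
  moreover have "k * (p ^ r choose k) = p ^ r * ((p ^ r - 1) choose (k - 1))"
    using assms(2) by (simp add: times_binomial_minus1_eq)
  then have "p ^ r dvd k * (p ^ r choose k)" by simp
  ultimately have "p ^ r dvd k" by (simp add: coprime_dvd_mult_left_iff)
  then show False using assms(2,3) by (simp add: nat_dvd_not_less)
qed

text \<open>By Pascal's rule, two neighbours in row \<open>p ^ r - 1\<close> add up to an inner
  entry of row \<open>p ^ r\<close>, a multiple of \<open>p\<close>. So indivisibility by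
  \<open>p\<close> spreads along the row from its first entry 1.\<close>

lemma prime_not_dvd_prime_power_minus_one_choose:
  fixes p r j :: nat
  assumes "prime p" "j \<le> p ^ r - 1"
  shows "\<not> p dvd ((p ^ r - 1) choose j)"
  using assms(2)
proof (induction j)
  case 0
  then show ?case using assms(1) by (simp add: prime_nat_iff)
next
  case (Suc j)
  have row: "Suc (p ^ r - 1) = p ^ r"
    using assms(1) by (simp add: prime_gt_0_nat)
  have "p dvd (p ^ r choose Suc j)"
    using Suc.prems row by (intro prime_dvd_prime_power_choose assms(1)) auto
  also have "p ^ r choose Suc j = ((p ^ r - 1) choose j) + ((p ^ r - 1) choose Suc j)"
    using binomial_Suc_Suc[of "p ^ r - 1" j] unfolding row .
  finally show ?case using Suc by (auto simp: dvd_add_left_iff)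
qed

lemma not_dvd_choose_of_prime_power:
  fixes a b n p r :: nat
  assumes "prime p" "p dvd a" "0 < r" "(a + b) * n = p ^ r - 1"
  shows "\<not> (b * n + 1) dvd ((a * n + b * n) choose (a * n))"
proof
  assume dvd: "(b * n + 1) dvd ((a * n + b * n) choose (a * n))"
  have row: "a * n + b * n = p ^ r - 1"
    using assms(4) by (simp add: algebra_simps)
  have "a * n + (b * n + 1) = p ^ r"
    using row assms(1) prime_gt_0_nat[of p] zero_less_power[of p r] by linarith
  moreover have "p dvd p ^ r" "p dvd a * n" using assms(2,3) by simp_all
  ultimately have "p dvd b * n + 1" by (metis dvd_add_right_iff)
  with dvd have "p dvd ((p ^ r - 1) choose (a * n))"
    unfolding row by (rule dvd_trans[rotated])
  moreover have "a * n \<le> p ^ r - 1" using row by linarith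
  ultimately show False
    using prime_not_dvd_prime_power_minus_one_choose[OF assms(1)] by blast
qed

lemma dvd_prime_power_totient_minus_one:
  fixes p m k :: nat
  assumes "prime p" "\<not> p dvd m"
  shows "m dvd p ^ (totient m * k) - 1"
proof -
  have "[(p ^ totient m) ^ k = 1 ^ k] (mod m)"
    using assms by (intro cong_pow euler_theorem prime_imp_coprime) auto
  then have "[p ^ (totient m * k) = 1] (mod m)" by (simp add: power_mult)
  then show ?thesis
    using cong_to_1_nat by blast
qed

theorem theorem2p1:
  fixes a b :: nat
  assumes "a > 0" and "b > 0"
    and "\<exists>p. prime p \<and> p dvd a \<and> \<not> p dvd b"
  shows "infinite {n::nat. n > 0 \<and> \<not> (b * n + 1) dvd ((a * n + b * n) choose (a * n))} \<and>
         (\<forall>p::nat. prime p \<and> p dvd a \<and> \<not> p dvd b \<longrightarrow>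
            real (f a b) \<le> (real p ^ totient (a + b) - 1) / real (a + b))"
proof -
  let ?P = "\<lambda>n::nat. n > 0 \<and> \<not> (b * n + 1) dvd ((a * n + b * n) choose (a * n))"
  \<comment> \<open>The free factor \<open>k\<close> serves both claims: large \<open>k\<close>
    gives arbitrarily large witnesses, and \<open>k = 1\<close> gives the bound on
    \<open>f a b\<close>.\<close>
  have wit: "\<exists>n. ?P n \<and> (a + b) * n = p ^ (totient (a + b) * k) - 1"
    if p: "prime p" "p dvd a" "\<not> p dvd b" and k: "0 < k" for p k :: nat
  proof -
    have r: "0 < totient (a + b) * k" using assms(1) k by simp
    have "\<not> p dvd a + b" using p by (simp add: dvd_add_right_iff)
    then obtain n where n: "(a + b) * n = p ^ (totient (a + b) * k) - 1"
      using dvd_prime_power_totient_minus_one[OF p(1)] by (metis dvdE)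
    have "1 < p ^ (totient (a + b) * k)"
      using prime_gt_1_nat[OF p(1)] r by (rule one_less_power)
    then have "n > 0" using n by (cases n) auto
    then show ?thesis using n not_dvd_choose_of_prime_power[OF p(1,2) r n] by blast
  qed
  have "infinite {n. ?P n}"
    unfolding infinite_nat_iff_unbounded
  proof
    fix m :: nat
    obtain p :: nat where p: "prime p" "p dvd a" "\<not> p dvd b" using assms(3) by blast
    \<comment> \<open>Since \<open>p ^ t > t\<close> for every \<open>t\<close>, the power exceeds
      \<open>k\<close>. Hence \<open>(a + b) * n\<close>, one less than the power, is still at least
      \<open>k\<close>, and cancelling \<open>a + b\<close> leaves
      \<open>n \<ge> Suc m\<close>.\<close>
    define k where "k = (a + b) * Suc m"
    have "0 < k" using assms(1) by (simp add: k_def)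
    then obtain n where n: "?P n" "(a + b) * n = p ^ (totient (a + b) * k) - 1"
      using wit[OF p] by blast
    have "k \<le> totient (a + b) * k" using assms(1) by (simp add: Suc_leI)
    also have "\<dots> < p ^ (totient (a + b) * k)"
      using prime_gt_1_nat[OF p(1)] by (simp add: power_gt_expt)
    finally have "(a + b) * Suc m \<le> (a + b) * n" unfolding n(2) k_def by linarith
    then have "m < n" using assms(1) by (simp add: Suc_le_eq del: mult_Suc_right)
    then show "\<exists>n>m. n \<in> {n. ?P n}" using n(1) by blast
  qed
  moreover have "real (f a b) \<le> (real p ^ totient (a + b) - 1) / real (a + b)"
    if p: "prime p" "p dvd a" "\<not> p dvd b" for p :: nat
  proof -
    obtain n where n: "?P n" "(a + b) * n = p ^ totient (a + b) - 1"
      using wit[OF p, of 1] by auto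
    \<comment> \<open>The witness \<open>n\<close> rules out the branch where \<open>f a b\<close>
      is 0 by convention.\<close>
    have "f a b = (LEAST n. ?P n)" using n(1) unfolding f_def by auto
    also have "\<dots> \<le> n" using n(1) by (rule Least_le)
    finally have "f a b \<le> n" .
    then have "real (f a b) \<le> real n" by simp
    also have "real n = (real p ^ totient (a + b) - 1) / real (a + b)"
    proof -
      \<comment> \<open>This makes the truncated subtraction on naturals agree with the real
        one.\<close>
      have "1 \<le> p ^ totient (a + b)" using prime_gt_0_nat[OF p(1)] by simp
      then have "real (a + b) * real n = real p ^ totient (a + b) - 1"
        using arg_cong[OF n(2), of real] by (simp add: of_nat_diff)
      then show ?thesis using assms(1) by (simp add: field_simps)
    qed
    finally show ?thesis .
  qed
  ultimately show ?thesis by blast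
qed

end
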